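(* Let $q$ be a prime power with $q\equiv 3\pmod 4$, let $d$ be a positive odd integer with $d\mid (q-1)$, let $\gamma$ be a primitive $d$th root of unity in $\mathbb{F}_q^*$, and let $n\ge u$ be an integer. Then $x^{2^nd}-1$ is a product of $d\bigl(2^{u-2}(n-u+2)+1\bigr)$ irreducible factors over $\mathbb{F}_q$, and $$x^{2^nd}-1=(x^{2^n}-1)\prod_{1\le j\le d-1}(x\pm\gamma^j)\prod_{\substack{2\le k\le u-1\\ 1\le i\le 2^{k-2}\\ 1\le j\le d-1}}\bigl(x^2-\gamma^j\,\mathbb{T}(\beta_{2^k}^{2i-1})\,x+\gamma^{2j}\bigr)\prod_{\substack{0\le r\le n-u\\ 1\le i\le 2^{u-3}\\ 1\le j\le d-1}}\bigl(x^{2^{r+1}}\pm\gamma^j\,\mathbb{T}(\beta_{2^u}^{2i-1})\,x^{2^r}-\gamma^{2j}\bigr),$$ where all displayed factors other than $x^{2^n}-1$ are irreducible over $\mathbb{F}_q$.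
   Context: $\mathbb{F}_q$ is the finite field with $q$ elements. Put $Q=q^2=2^uv+1$ with $v$ odd (so $u\ge 3$ since $q\equiv 3\pmod 4$). For $0\le k\le u$, $\beta_{2^k}$ is a primitive $2^k$th root of unity in $\mathbb{F}_Q^*$. $\mathbb{T}:\mathbb{F}_Q\to\mathbb{F}_q$ is the trace $\mathbb{T}(x)=x+x^q$. A factor written with $\pm$ in a product stands for the product of the two factors obtained from the two sign choices. *)

theory Defs
  imports
    "HOL-Computational_Algebra.Computational_Algebra"
    "HOL-Number_Theory.Number_Theory"
    "HOL-Library.Cardinality"
begin

definition primitive_root_of_unity :: "nat \<Rightarrow> 'a::field \<Rightarrow> bool" where
  "primitive_root_of_unity m x \<longleftrightarrow>
     m > 0 \<and> x ^ m = 1 \<and> (\<forall>l. 0 < l \<and> l < m \<longrightarrow> x ^ l \<noteq> 1)"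

text \<open>An extension of fields is given by an embedding between two field types;
  injectivity follows from the three conditions.\<close>

definition field_embedding :: "('a::field \<Rightarrow> 'b::field) \<Rightarrow> bool" where
  "field_embedding \<iota> \<longleftrightarrow>
     \<iota> 1 = 1 \<and> (\<forall>x y. \<iota> (x + y) = \<iota> x + \<iota> y) \<and> (\<forall>x y. \<iota> (x * y) = \<iota> x * \<iota> y)"

text \<open>The trace of the quadratic extension \<open>\<iota>\<close> of finite fields, with values in the
  smaller field: the preimage of \<open>x + x\<^sup>q\<close> under \<open>\<iota>\<close>, where \<open>q = CARD('a)\<close>.  Existence and
  uniqueness of the preimage are shown in \<open>field_embedding_quadratic_trace\<close>.\<close>

definition quadratic_trace :: "('a::finite_field \<Rightarrow> 'b::finite_field) \<Rightarrow> 'b \<Rightarrow> 'a" where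
  "quadratic_trace \<iota> x = (THE y. \<iota> y = x + x ^ CARD('a))"

lemma field_embedding_inj:
  assumes "field_embedding \<iota>"
  shows "inj \<iota>"
proof -
  have one: "\<iota> 1 = 1" and add: "\<And>x y. \<iota> (x + y) = \<iota> x + \<iota> y"
    and mult: "\<And>x y. \<iota> (x * y) = \<iota> x * \<iota> y"
    using assms by (auto simp: field_embedding_def)
  have zero: "\<iota> 0 = 0"
    using add[of 0 0] by (metis add_cancel_right_right add_0)
  show ?thesis
  proof (rule injI)
    fix x y assume eq: "\<iota> x = \<iota> y"
    show "x = y"
    proof (rule ccontr)
      assume "x \<noteq> y"
      then have "(x - y) * inverse (x - y) = 1" by simp
      then have "\<iota> (x - y) * \<iota> (inverse (x - y)) = 1"
        by (metis mult one)
      moreover have "\<iota> (x - y) = 0"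
        using add[of "x - y" y] eq by simp
      ultimately show False by simp
    qed
  qed
qed

lemma field_embedding_power:
  assumes "field_embedding \<iota>"
  shows "\<iota> (x ^ m) = \<iota> x ^ m"
  using assms by (induction m) (auto simp: field_embedding_def)

lemma field_embedding_quadratic_trace:
  fixes \<iota> :: "'a::finite_field \<Rightarrow> 'b::finite_field"
  assumes emb: "field_embedding \<iota>" and pp: "primepow CARD('a)"
    and card: "CARD('b) = CARD('a) ^ 2"
  shows "\<iota> (quadratic_trace \<iota> x) = x + x ^ CARD('a)"
proof -
  define q where "q = CARD('a)"
  have q1: "q > 1"
    using pp primepow_gt_Suc_0 by (auto simp: q_def)
  have range: "range \<iota> = {y. y ^ q = y}"
  proof (rule card_subset_eq)
    show "range \<iota> \<subseteq> {y. y ^ q = y}"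
      using finite_field_power_card_eq_same[where ?'a = 'a]
      by (auto simp: q_def simp flip: field_embedding_power[OF emb])
    define P :: "'b poly" where "P = Polynomial.monom 1 q - Polynomial.monom 1 1"
    have "Polynomial.coeff P q = 1"
      using q1 by (simp add: P_def)
    then have "P \<noteq> 0" by auto
    have "Polynomial.degree P \<le> q"
      unfolding P_def using q1 by (intro degree_diff_le) (auto simp: degree_monom_le degree_monom_eq)
    then have "card {y. poly P y = 0} \<le> q"
      using card_poly_roots_bound[OF \<open>P \<noteq> 0\<close>] by linarith
    also have "{y. poly P y = 0} = {y. y ^ q = y}"
      by (simp add: P_def poly_monom)
    finally have "card {y::'b. y ^ q = y} \<le> q" .
    moreover have "card (range \<iota>) = q"
      by (simp add: card_image field_embedding_inj[OF emb] q_def)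
    moreover have "card (range \<iota>) \<le> card {y::'b. y ^ q = y}"
      by (rule card_mono) (use \<open>range \<iota> \<subseteq> _\<close> in auto)
    ultimately show "card (range \<iota>) = card {y::'b. y ^ q = y}" by linarith
  qed auto
  obtain p k where p: "prime p" "q = p ^ k"
    using pp by (auto simp: primepow_def q_def)
  have "CHAR('b) dvd q ^ 2"
    using CHAR_dvd_CARD[where ?'a = 'b] card by (simp add: q_def)
  then have "CHAR('b) dvd p"
    using prime_dvd_power[of "CHAR('b)"] CHAR_prime[where ?'a = 'b] p(2) by metis
  then have "CHAR('b) = p"
    using p(1) CHAR_prime[where ?'a = 'b] primes_dvd_imp_eq by blast
  then have q: "q = CHAR('b) ^ k"
    using p by simp
  have "(x + x ^ q) ^ q = x ^ q + (x ^ q) ^ q"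
    by (rule freshmans_dream'[OF _ q]) simp
  also have "(x ^ q) ^ q = x"
    using finite_field_power_card_eq_same[of x] card
    by (simp add: q_def power2_eq_square power_mult)
  finally have "x + x ^ q \<in> range \<iota>"
    by (simp add: range add.commute)
  then obtain y where y: "\<iota> y = x + x ^ q" by force
  show ?thesis
    unfolding quadratic_trace_def q_def[symmetric]
    by (rule theI[of _ y]) (use y field_embedding_inj[OF emb] in \<open>auto simp: inj_def\<close>)
qed

end

theory Submission
  imports Defs
begin

text \<open>Let \<open>\<zeta>\<close> be a primitive \<open>2\<^sup>k\<close>th root of unity in the field with \<open>q\<^sup>2\<close> elements, where
  \<open>2 \<le> k \<le> u\<close>. Since \<open>q \<equiv> 3 (mod 4)\<close>, the number \<open>q + 1\<close> is an odd multiple of \<open>2\<^sup>u\<^sup>-\<^sup>1\<close>. So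
  \<open>\<zeta>\<close> has norm \<open>\<zeta>\<^sup>q\<^sup>+\<^sup>1 = 1\<close> if \<open>k < u\<close> and norm \<open>- 1\<close> if \<open>k = u\<close>, and the polynomials
  \<open>X\<^sup>2 - c T(\<zeta>\<^sup>a) X + c\<^sup>2\<close> and \<open>X\<^sup>2 \<plusminus> c T(\<zeta>\<^sup>a) X - c\<^sup>2\<close>, respectively, have the roots
  \<open>c \<zeta>\<^sup>b\<close> with \<open>b\<close> odd (in pairs of conjugates). Over half, respectively a quarter, of the odd
  exponents \<open>a\<close> they multiply to a binomial \<open>X^(2^(k - 1)) + c^(2^(k - 1))\<close>. This is
  \<open>quadratic_trace_product\<close> and \<open>quadratic_trace_product_norm_minus_one\<close>; the second reduces to
  the first for \<open>\<zeta>\<^sup>2\<close>. Both are derived inside the small field, from the relation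
  between \<open>T(x)\<^sup>2\<close> and \<open>T(x\<^sup>2)\<close> and a reflection rule, by pairing factors and
  induction on the power of two (\<open>half_trace_product\<close>). Substituting \<open>X^(2^r)\<close> for \<open>X\<close> in the
  case \<open>k = u\<close> yields the binomials of higher degree.

  Now take \<open>c = \<gamma>\<^sup>j\<close> and multiply over \<open>j\<close>. Because \<open>d\<close> is odd, squaring permutes the powers of
  \<open>\<gamma>\<close>, so exponents that are powers of two may be dropped from the constant terms. The
  identities \<open>(X\<^sup>N - 1) (X\<^sup>N + 1) = X\<^sup>2\<^sup>N - 1\<close> then telescope to
  \<open>\<Prod>\<^sub>j (X^(2^n) - \<gamma>\<^sup>j)\<close> (\<open>prod_factors_eq\<close>). Over all residues \<open>j\<close> this is
  \<open>X^(2^n d) - 1\<close>; the residue \<open>j = 0\<close> contributes the factor \<open>X^(2^n) - 1\<close>.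

  Every factor \<open>F\<close> of higher degree divides some \<open>X^(2^s) + b\<close> with \<open>b\<^sup>d = 1\<close>. If \<open>g\<close> is an
  irreducible factor of \<open>F\<close> of degree \<open>e\<close>, the order of \<open>X\<close> modulo \<open>g\<close> is a multiple of
  \<open>2^(s + 1)\<close> and divides \<open>q\<^sup>e - 1\<close>. The power of two in \<open>q\<^sup>e - 1\<close> is small unless \<open>e\<close> is
  itself divisible by a high power of two, and the comparison gives \<open>deg F \<le> e\<close>. So \<open>F\<close> is irreducible
  (\<open>irreducible_if_dvd_binomial\<close>, \<open>power_two_dvd_power_diff_imp_dvd_exponent\<close>). The same
  factors with \<open>j = 0\<close> are also irreducible, and counting over all residues \<open>j\<close> gives the number
  of irreducible factors.\<close>

section \<open>Powers of two dividing q^e - 1\<close>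

lemma dvd_power_diff_imp_even:
  fixes q e :: nat
  assumes "q mod 4 = 3" and "4 dvd q ^ e - 1"
  shows "even e"
proof (rule ccontr)
  assume "odd e"
  then obtain m where e: "e = 2 * m + 1" by (elim oddE)
  have "[q = 3] (mod 4)" using assms(1) by (simp add: cong_def)
  then have "[q ^ 2 = 3 ^ 2] (mod 4)" by (rule cong_pow)
  then have "[q ^ 2 = 1] (mod 4)" by (simp add: cong_def)
  then have "[(q ^ 2) ^ m * q = 1 ^ m * 3] (mod 4)"
    by (intro cong_mult cong_pow) (use \<open>[q = 3] (mod 4)\<close> in auto)
  moreover have "(q ^ 2) ^ m * q = q ^ e" by (simp only: e power_add power_mult power_one_right)
  ultimately have "q ^ e mod 4 = 3" by (simp add: cong_def)
  with assms(2) show False by presburger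
qed

text \<open>For \<open>Q \<equiv> 1 (mod 4)\<close>, raising \<open>Q\<close> to an odd power does not change the power of two in
  \<open>Q - 1\<close>, because the cofactor \<open>1 + Q + \<dots> + Q\<^sup>m\<^sup>-\<^sup>1\<close> is a sum of an odd number of odd terms.
  Squaring adds exactly one factor two, because \<open>Q\<^sup>l + 1 \<equiv> 2 (mod 4)\<close>.\<close>

lemma power_two_dvd_power_diff:
  fixes Q u v r m :: nat
  assumes Q: "Q = 2 ^ u * v + 1" and u: "u \<ge> 2" and v: "odd v"
    and dvd: "2 ^ (u + r) dvd Q ^ m - 1"
  shows "2 ^ r dvd m"
  using dvd
proof (induction r arbitrary: m)
  case (Suc r)
  have Q4: "[Q ^ l = 1] (mod 4)" for l
  proof -
    have "(4::nat) dvd 2 ^ u" using le_imp_power_dvd[OF u, of "2::nat"] by simp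
    then have "4 dvd Q - 1" unfolding Q by simp
    then have "[Q = 1] (mod 4)" by (subst cong_altdef_nat) (simp_all add: Q)
    from cong_pow[OF this, of l] show ?thesis by simp
  qed
  have pos: "Q ^ l \<ge> 1" for l by (simp add: Q)
  have "even m"
  proof (rule ccontr)
    assume "odd m"
    have "Q ^ m - 1 = (Q - 1) * (\<Sum>i<m. Q ^ i)"
    proof -
      have "int Q ^ m - 1 = (int Q - 1) * (\<Sum>i<m. int Q ^ i)"
        by (rule power_diff_1_eq)
      then have "int (Q ^ m - 1) = int ((Q - 1) * (\<Sum>i<m. Q ^ i))"
        using pos[of m] pos[of 1] by (simp add: of_nat_diff)
      then show ?thesis by (simp only: of_nat_eq_iff)
    qed
    also have "\<dots> = 2 ^ u * (v * (\<Sum>i<m. Q ^ i))" by (simp add: Q)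
    finally have "2 ^ u * (2 * 2 ^ r) dvd 2 ^ u * (v * (\<Sum>i<m. Q ^ i))"
      using Suc.prems by (simp only: power_add power_Suc)
    then have "2 * 2 ^ r dvd v * (\<Sum>i<m. Q ^ i)" by (subst (asm) nat_mult_dvd_cancel_disj) simp
    then have "2 dvd v * (\<Sum>i<m. Q ^ i)" by (rule dvd_mult_left)
    moreover have "odd (\<Sum>i<m. Q ^ i)"
    proof -
      have "odd (Q ^ i)" for i using u by (simp add: Q)
      then show ?thesis using \<open>odd m\<close> by (simp add: even_sum_iff)
    qed
    ultimately show False using v by simp
  qed
  then obtain l where m: "m = 2 * l" by (elim evenE)
  have fact: "Q ^ m - 1 = (Q ^ l - 1) * (Q ^ l + 1)"
  proof -
    have "Q ^ m = Q ^ l * Q ^ l" by (simp only: m mult_2 power_add)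
    then show ?thesis using pos[of l] by (simp add: diff_mult_distrib)
  qed
  obtain w where w: "Q ^ l + 1 = 2 * w" "odd w"
  proof -
    have "Q ^ l mod 4 = 1" using Q4[of l] by (simp add: cong_def)
    then have "Q ^ l + 1 = 2 * ((Q ^ l + 1) div 2)" "odd ((Q ^ l + 1) div 2)"
      by presburger+
    then show ?thesis using that by blast
  qed
  have "2 * 2 ^ (u + r) dvd 2 * (w * (Q ^ l - 1))"
    using Suc.prems unfolding fact w(1) by (simp add: mult_ac)
  then have "2 ^ (u + r) dvd w * (Q ^ l - 1)" by (subst (asm) nat_mult_dvd_cancel_disj) simp
  then have "2 ^ (u + r) dvd Q ^ l - 1"
    using w(2) by (simp add: coprime_dvd_mult_right_iff)
  from Suc.IH[OF this] show ?case by (simp add: m)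
qed simp

text \<open>Here \<open>q \<equiv> 3 (mod 4)\<close>, so odd exponents contribute a single factor two, and for even exponents
  one passes to \<open>Q = q\<^sup>2\<close>. This is the bound that turns a root of large 2-power order into a root
  of large degree.\<close>

lemma power_two_dvd_power_diff_imp_dvd_exponent:
  fixes q u v r e :: nat
  assumes "q mod 4 = 3" and "q ^ 2 = 2 ^ u * v + 1" and "odd v" and "u \<ge> 2"
    and "2 ^ (u + r) dvd q ^ e - 1"
  shows "2 ^ (r + 1) dvd e"
proof -
  have "2 ^ 2 dvd (2::nat) ^ (u + r)" using assms(4) by (intro le_imp_power_dvd) simp
  from dvd_trans[OF this assms(5)] have "4 dvd q ^ e - 1" by simp
  then have "even e" by (rule dvd_power_diff_imp_even[OF assms(1)])
  then obtain m where e: "e = 2 * m" by (elim evenE)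
  have "2 ^ r dvd m"
    by (rule power_two_dvd_power_diff[OF assms(2,4,3)]) (use assms(5) in \<open>simp only: e power_mult\<close>)
  then show ?thesis by (simp add: e)
qed

text \<open>Since \<open>q - 1\<close> is twice an odd number, all but one of the factors two of \<open>q\<^sup>2 - 1\<close> lie in
  \<open>q + 1\<close>. Hence \<open>q + 1\<close> is a multiple of \<open>2\<^sup>k\<close> for \<open>k < u\<close>, and an odd multiple of
  \<open>2\<^sup>u\<^sup>-\<^sup>1\<close>: these are the two cases of the norm of a root of unity of order \<open>2\<^sup>k\<close>.\<close>

lemma split_power_two_factor:
  fixes q u v :: nat
  assumes "q mod 4 = 3" and "q ^ 2 = 2 ^ u * v + 1" and "odd v"
  shows "u \<ge> 3 \<and> (\<exists>w. odd w \<and> q + 1 = 2 ^ (u - 1) * w)"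
proof -
  define h k where "h = q div 2" and "k = q div 4"
  have q: "q = 2 * h + 1" "q = 4 * k + 3" "odd h"
    using assms(1) unfolding h_def k_def by presburger+
  have "2 ^ u * v = (q - 1) * (q + 1)"
    using assms(2) q(1) by (simp add: power2_eq_square)
  then have eq: "2 ^ u * v = 2 * (h * (q + 1))" by (simp add: q(1))
  have "2 ^ 3 dvd 2 ^ u * v"
  proof -
    have "q + 1 = 4 * (k + 1)" using q(2) by simp
    then have "2 ^ u * v = 2 * (h * (4 * (k + 1)))" unfolding eq by (simp only:)
    also have "\<dots> = 2 ^ 3 * (h * (k + 1))" by (simp add: algebra_simps)
    finally have "2 ^ u * v = 2 ^ 3 * (h * (k + 1))" .
    then show ?thesis by (rule dvdI)
  qed
  moreover have "coprime (2 ^ 3) v" using assms(3) by (simp only: coprime_power_left_iff coprime_left_2_iff_odd simp_thms)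
  ultimately have "2 ^ 3 dvd (2::nat) ^ u" using coprime_dvd_mult_left_iff by blast
  then have u: "u \<ge> 3" by (rule power_dvd_imp_le) simp
  then have u1: "(2::nat) ^ u = 2 * 2 ^ (u - 1)" by (cases u) auto
  have eq': "2 ^ (u - 1) * v = h * (q + 1)" using eq unfolding u1 by simp
  then have "2 ^ (u - 1) dvd h * (q + 1)" by (metis dvd_triv_left)
  then have "2 ^ (u - 1) dvd q + 1"
    using q(3) by (subst (asm) coprime_dvd_mult_right_iff) auto
  then obtain w where w: "q + 1 = 2 ^ (u - 1) * w" by (elim dvdE)
  from eq' have "2 ^ (u - 1) * v = 2 ^ (u - 1) * (h * w)" unfolding w by (simp add: mult_ac)
  then have "v = h * w" by simp
  with assms(3) have "odd w" by simp
  with u w show ?thesis by blast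
qed

section \<open>An irreducibility criterion over finite fields\<close>

text \<open>The remainders modulo a polynomial of degree \<open>n\<close>. Bounding the support of the coefficients
  instead of the degree keeps the zero polynomial in the set when \<open>n = 0\<close>.\<close>

lemma card_polys_degree_less:
  "finite {p :: 'a::{finite,zero} poly. \<forall>i\<ge>n. Polynomial.coeff p i = 0} \<and>
   card {p :: 'a poly. \<forall>i\<ge>n. Polynomial.coeff p i = 0} = CARD('a) ^ n"
proof (induction n)
  case 0
  have "{p :: 'a poly. \<forall>i\<ge>0. Polynomial.coeff p i = 0} = {0}"
    by (auto simp: poly_eq_iff)
  then show ?case by simp
next
  case (Suc n)
  let ?R = "\<lambda>n. {p :: 'a poly. \<forall>i\<ge>n. Polynomial.coeff p i = 0}"
  have "?R (Suc n) = (\<lambda>(a, p). pCons a p) ` (UNIV \<times> ?R n)"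
  proof (intro equalityI subsetI)
    fix p assume p: "p \<in> ?R (Suc n)"
    obtain a r where "p = pCons a r" by (cases p)
    moreover from this p have "r \<in> ?R n" by (fastforce simp: coeff_pCons split: nat.splits)
    ultimately show "p \<in> (\<lambda>(a, p). pCons a p) ` (UNIV \<times> ?R n)" by auto
  qed (auto simp: coeff_pCons split: nat.splits)
  moreover have "inj_on (\<lambda>(a, p :: 'a poly). pCons a p) (UNIV \<times> ?R n)"
    by (auto simp: inj_on_def)
  ultimately show ?case using Suc by (simp add: card_image card_cartesian_product)
qed

text \<open>The residue ring modulo \<open>g\<close> is a field with \<open>q\<^sup>n\<close> elements, where \<open>q\<close> is the order of the
  coefficient field and \<open>n\<close> the degree of \<open>g\<close>. As in the proof of
  Fermat's little theorem, multiplication by \<open>a\<close> permutes the nonzero remainders; comparing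
  the product of all of them before and after gives the claim without constructing that field.\<close>

lemma irreducible_poly_fermat:
  fixes g a :: "'a::{field,finite} poly"
  assumes irr: "Factorial_Ring.irreducible g" and a: "\<not> g dvd a"
  shows "[a ^ (CARD('a) ^ Polynomial.degree g - 1) = 1] (mod g)"
proof -
  have prime: "prime_elem g" by (rule field_poly_irreducible_imp_prime[OF irr])
  then have g0: "g \<noteq> 0" by auto
  define R where "R = {p :: 'a poly. \<forall>i\<ge>Polynomial.degree g. Polynomial.coeff p i = 0}"
  have R: "finite R" "card R = CARD('a) ^ Polynomial.degree g"
    using card_polys_degree_less[where ?'a = 'a and n = "Polynomial.degree g"] by (auto simp: R_def)
  have R_less: "p \<in> R \<longleftrightarrow> p = 0 \<or> Polynomial.degree p < Polynomial.degree g" for p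
    by (auto simp: R_def coeff_eq_0 not_le intro: leading_coeff_neq_0 dest!: spec[of _ "Polynomial.degree p"])
  have ndvd: "\<not> g dvd p" if "p \<in> R - {0}" for p
    using that R_less dvd_imp_degree_le[of g p] by auto
  define f where "f p = (a * p) mod g" for p
  have "inj_on f (R - {0})"
  proof (rule inj_onI)
    fix p p' assume pp: "p \<in> R - {0}" "p' \<in> R - {0}" and "f p = f p'"
    then have "g dvd a * (p - p')"
      by (simp add: f_def mod_eq_dvd_iff right_diff_distrib)
    then have "g dvd p - p'" using prime a by (simp add: prime_elem_dvd_mult_iff)
    moreover have "p - p' \<in> R" using pp by (auto simp: R_def)
    ultimately show "p = p'" using ndvd[of "p - p'"] by auto
  qed
  moreover have "f ` (R - {0}) \<subseteq> R - {0}"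
  proof
    fix y assume "y \<in> f ` (R - {0})"
    then obtain p where p: "p \<in> R - {0}" "y = (a * p) mod g" by (auto simp: f_def)
    have "\<not> g dvd a * p" using prime a ndvd[OF p(1)] by (simp add: prime_elem_dvd_mult_iff)
    then show "y \<in> R - {0}"
      using degree_mod_less[OF g0, of "a * p"] by (auto simp: p(2) R_less dvd_eq_mod_eq_0)
  qed
  ultimately have bij: "bij_betw f (R - {0}) (R - {0})"
    using R(1) by (simp add: bij_betw_def endo_inj_surj)
  have "[(\<Prod>p\<in>R - {0}. a * p) = (\<Prod>p\<in>R - {0}. f p)] (mod g)"
    by (rule cong_prod) (simp add: f_def)
  also have "(\<Prod>p\<in>R - {0}. f p) = \<Prod>(R - {0})"
    using prod.reindex_bij_betw[OF bij, of "\<lambda>p. p"] by simp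
  also have "(\<Prod>p\<in>R - {0}. a * p) = a ^ (CARD('a) ^ Polynomial.degree g - 1) * \<Prod>(R - {0})"
  proof -
    have "0 \<in> R" by (simp add: R_def)
    then show ?thesis using R by (simp add: prod.distrib)
  qed
  finally have "g dvd (a ^ (CARD('a) ^ Polynomial.degree g - 1) - 1) * \<Prod>(R - {0})"
    by (simp add: cong_iff_dvd_diff left_diff_distrib)
  moreover have "\<not> g dvd \<Prod>(R - {0})"
  proof -
    have "\<not> g dvd \<Prod>A" if "finite A" "\<forall>p\<in>A. \<not> g dvd p" for A
      using that
    proof (induction A rule: finite_induct)
      case empty
      show ?case using prime_elem_not_unit[OF prime] by simp
    next
      case (insert p A)
      then show ?case using prime by (simp add: prime_elem_dvd_mult_iff)
    qed
    then show ?thesis using ndvd R(1) by blast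
  qed
  ultimately show ?thesis
    using prime by (auto simp: prime_elem_dvd_mult_iff cong_iff_dvd_diff)
qed

lemma exists_irreducible_factor:
  fixes p :: "'a::field poly"
  assumes "Polynomial.degree p > 0"
  shows "\<exists>g. Factorial_Ring.irreducible g \<and> g dvd p"
  using assms
proof (induction "Polynomial.degree p" arbitrary: p rule: less_induct)
  case less
  then have p0: "p \<noteq> 0" by auto
  show ?case
  proof (cases "Factorial_Ring.irreducible p")
    case False
    then obtain a b where ab: "p = a * b" "\<not> a dvd 1" "\<not> b dvd 1"
      using less.prems p0 unfolding Factorial_Ring.irreducible_def
      by (auto simp: is_unit_iff_degree)
    from ab p0 have ne: "a \<noteq> 0" "b \<noteq> 0" by auto
    with ab have "Polynomial.degree a > 0" "Polynomial.degree b > 0"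
      by (auto simp: is_unit_iff_degree)
    moreover from this have "Polynomial.degree a < Polynomial.degree p"
      using ab(1) ne by (simp add: degree_mult_eq)
    ultimately obtain g where "Factorial_Ring.irreducible g" "g dvd a" using less.hyps by blast
    then show ?thesis using ab(1) by auto
  qed auto
qed

text \<open>Let \<open>g\<close> be an irreducible factor of \<open>F\<close>, of degree \<open>e\<close>. Modulo \<open>g\<close> the variable satisfies
  \<open>X^(2^s) = - b\<close>, and raising this to the odd power \<open>d\<close> gives \<open>X^(2^s d) = - 1\<close>. So the order of
  \<open>X\<close> has the 2-part \<open>2^(s + 1)\<close>, and it divides \<open>q^e - 1\<close>. The last hypothesis now says that
  \<open>deg F\<close> divides \<open>e\<close>, which leaves no room for a cofactor of \<open>g\<close>.\<close>

lemma irreducible_if_dvd_binomial: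
  fixes F :: "'a::{field,finite} poly" and b :: 'a
  assumes two: "(2::'a) \<noteq> 0"
    and F: "F dvd Polynomial.monom 1 (2 ^ s) + [:b:]" "Polynomial.degree F > 0"
    and b: "b ^ d = 1" "odd d"
    and deg: "\<And>e. 2 ^ (s + 1) dvd CARD('a) ^ e - 1 \<Longrightarrow> Polynomial.degree F dvd e"
  shows "Factorial_Ring.irreducible F"
proof -
  obtain g where g: "Factorial_Ring.irreducible g" "g dvd F"
    using exists_irreducible_factor[OF F(2)] by blast
  define e K where "e = Polynomial.degree g" and "K = CARD('a) ^ e - 1"
  define X :: "'a poly" where "X = Polynomial.monom 1 1"
  have F0: "F \<noteq> 0" and g0: "g \<noteq> 0" using F(2) g by auto
  have e: "e > 0" using g(1) g0 unfolding e_def Factorial_Ring.irreducible_def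
    by (auto simp: is_unit_iff_degree)
  have const: "\<not> g dvd [:c:]" if "c \<noteq> 0" for c
    using that e dvd_imp_degree_le[of g "[:c:]"] by (auto simp: e_def)
  have "X ^ 2 ^ s = Polynomial.monom 1 (2 ^ s)" by (simp add: X_def monom_power)
  then have "g dvd X ^ 2 ^ s - - [:b:]" using dvd_trans[OF g(2) F(1)]
    by (simp only: diff_minus_eq_add)
  then have X: "[X ^ 2 ^ s = - [:b:]] (mod g)" by (simp only: cong_iff_dvd_diff)
  have b0: "b \<noteq> 0" using b odd_pos[OF b(2)] by (auto simp: zero_power)
  have "\<not> g dvd X"
  proof
    assume "g dvd X"
    then have "g dvd X ^ 2 ^ s" by (simp add: dvd_power_le[of g X 1, simplified])
    with X have "g dvd - [:b:]" by (metis cong_def dvd_eq_mod_eq_0)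
    then have "g dvd [:b:]" by (simp only: dvd_minus_iff)
    with const b0 show False by blast
  qed
  then have fermat: "[X ^ K = 1] (mod g)"
    using irreducible_poly_fermat[OF g(1)] by (simp add: K_def e_def)
  have K: "K > 0"
  proof -
    have "card {0, 1 :: 'a} \<le> CARD('a)" by (rule card_mono) auto
    then show ?thesis using one_less_power[of "CARD('a)" e] e by (simp add: K_def)
  qed
  (* Otherwise an odd multiple of 2^s d is a multiple of K, so that one power of X is both 1 and -1. *)
  have "2 ^ (s + 1) dvd K"
  proof (rule ccontr)
    assume n: "\<not> 2 ^ (s + 1) dvd K"
    obtain t m where K_eq: "K = 2 ^ t * m" "odd m"
      using multiplicity_decompose'[of K 2] K by (metis neq0_conv odd_one)
    have ts: "t \<le> s"
    proof (rule ccontr)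
      assume "\<not> t \<le> s"
      then have "2 ^ (s + 1) dvd (2::nat) ^ t" by (intro le_imp_power_dvd) simp
      with n K_eq(1) show False by simp
    qed
    have "[(X ^ 2 ^ s) ^ (d * m) = (- [:b:]) ^ (d * m)] (mod g)" by (rule cong_pow[OF X])
    also have "(- [:b:]) ^ (d * m) = - 1"
    proof -
      have "(- [:b:]) ^ (d * m) = - ([:b:] ^ (d * m))"
        using b(2) K_eq(2) by (intro power_minus_odd) simp
      also have "[:b:] ^ (d * m) = [:(b ^ d) ^ m:]" by (simp add: poly_const_pow power_mult)
      finally show ?thesis by (simp add: b(1) one_pCons)
    qed
    also have "(X ^ 2 ^ s) ^ (d * m) = (X ^ K) ^ (2 ^ (s - t) * d)"
    proof -
      have "(2::nat) ^ s = 2 ^ t * 2 ^ (s - t)" using ts by (simp flip: power_add)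
      then show ?thesis by (simp add: K_eq(1) mult_ac flip: power_mult)
    qed
    finally have "[(X ^ K) ^ (2 ^ (s - t) * d) = - 1] (mod g)" .
    moreover have "[(X ^ K) ^ (2 ^ (s - t) * d) = 1] (mod g)"
      using cong_pow[OF fermat, of "2 ^ (s - t) * d"] by simp
    ultimately have "[1 = - 1] (mod g)" using cong_sym cong_trans by blast
    then have "g dvd 1 - (- 1)" by (simp only: cong_iff_dvd_diff)
    also have "1 - (- 1) = [:2::'a:]" by (simp add: numeral_poly)
    finally show False using const[OF two] by contradiction
  qed
  then have "Polynomial.degree F \<le> e"
    using deg[of e] e by (auto simp: K_def intro: dvd_imp_le)
  moreover obtain h where h: "F = g * h" using g(2) by blast
  ultimately have "Polynomial.degree h = 0"
    using F0 by (auto simp: degree_mult_eq e_def)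
  then have "h dvd 1" using h F0 by (subst is_unit_iff_degree) auto
  then show ?thesis using g(1) h by (simp add: irreducible_mult_unit_left mult.commute[of g])
qed

section \<open>Products over half of the traces\<close>

lemma power_swap: "(x ^ m) ^ n = (x ^ n) ^ m" for x :: "'a::monoid_mult"
  by (metis mult.commute power_mult)

text \<open>The model is \<open>t a = z\<^sup>a + z\<^sup>-\<^sup>a\<close> with \<open>z^(2^m) = - 1\<close>. Then the factor with index \<open>a\<close> has the
  roots \<open>c z\<^sup>a\<close> and \<open>c z\<^sup>-\<^sup>a\<close>, and the product collects each root of \<open>X^(2^m) + c^(2^m)\<close> once.
  Describing \<open>t\<close> by functional equations keeps the coefficients in the smaller field, which \<open>z\<close>
  does not lie in. By the reflection rule the indices \<open>a\<close> and
  \<open>2^(m + 1) - a\<close> give factors that differ in the sign of the middle term; their product is a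
  factor of the same shape in \<open>X\<^sup>2\<close>, \<open>c\<^sup>2\<close> and \<open>t (2 a)\<close>, with \<open>m\<close> in place of \<open>m + 1\<close>.\<close>

lemma half_trace_product:
  fixes X c :: "'r::idom" and t :: "nat \<Rightarrow> 'r"
  assumes two: "(2::'r) \<noteq> 0" and m: "m \<ge> 1"
    and double: "\<And>a. t a ^ 2 = t (2 * a) + 2"
    and reflect: "\<And>a. a \<le> 2 ^ m \<Longrightarrow> t (2 ^ m - a) = - t a"
  shows "(\<Prod>i\<in>{1..2 ^ (m - 1)}. X ^ 2 - c * t (2 * i - 1) * X + c ^ 2) = X ^ 2 ^ m + c ^ 2 ^ m"
  using m double reflect
proof (induction m arbitrary: X c t rule: dec_induct)
  case base
  (* The index 1 is its own reflection, so its trace is zero. *)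
  have "t (2 ^ 1 - 1) = - t 1" by (rule base(2)) simp
  then have "t (2 ^ 1 - 1) + t 1 = 0" by (simp only: left_minus)
  then have "2 * t 1 = 0" by simp
  with two have "t 1 = 0" by simp
  then show ?case by simp
next
  case (step m)
  let ?g = "\<lambda>a. X ^ 2 - c * t a * X + c ^ 2"
  have pow: "(2::nat) ^ m = 2 ^ (m - 1) + 2 ^ (m - 1)" using step.hyps by (cases m) auto
  have "(\<Prod>i\<in>{1..2 ^ m}. ?g (2 * i - 1))
      = (\<Prod>i\<in>{1..2 ^ (m - 1)}. ?g (2 * i - 1)) * (\<Prod>i\<in>{2 ^ (m - 1) + 1..2 ^ m}. ?g (2 * i - 1))"
    by (subst prod.union_disjoint [symmetric]) (auto simp: pow intro!: prod.cong)
  also have "(\<Prod>i\<in>{2 ^ (m - 1) + 1..2 ^ m}. ?g (2 * i - 1))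
      = (\<Prod>i\<in>{1..2 ^ (m - 1)}. ?g (2 ^ Suc m - (2 * i - 1)))"
    by (rule prod.reindex_bij_witness[of _ "\<lambda>i. 2 ^ m + 1 - i" "\<lambda>i. 2 ^ m + 1 - i"])
      (auto simp: pow diff_mult_distrib2)
  also have "\<dots> = (\<Prod>i\<in>{1..2 ^ (m - 1)}. X ^ 2 + c * t (2 * i - 1) * X + c ^ 2)"
  proof (rule prod.cong)
    fix i :: nat assume "i \<in> {1..2 ^ (m - 1)}"
    then have "i \<le> 2 ^ m" using pow by simp
    then have "2 * i - 1 \<le> 2 ^ Suc m" by simp
    from step.prems(2)[OF this]
    show "?g (2 ^ Suc m - (2 * i - 1)) = X ^ 2 + c * t (2 * i - 1) * X + c ^ 2" by simp
  qed simp
  also have "(\<Prod>i\<in>{1..2 ^ (m - 1)}. ?g (2 * i - 1)) * \<dots>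
      = (\<Prod>i\<in>{1..2 ^ (m - 1)}. (X ^ 2) ^ 2 - c ^ 2 * t (2 * (2 * i - 1)) * X ^ 2 + (c ^ 2) ^ 2)"
    unfolding prod.distrib[symmetric]
  proof (rule prod.cong)
    fix i :: nat
    have t2: "t (2 * (2 * i - 1)) = t (2 * i - 1) ^ 2 - 2" using step.prems(1) by simp
    show "?g (2 * i - 1) * (X ^ 2 + c * t (2 * i - 1) * X + c ^ 2)
        = (X ^ 2) ^ 2 - c ^ 2 * t (2 * (2 * i - 1)) * X ^ 2 + (c ^ 2) ^ 2"
      unfolding t2 by (simp add: power2_eq_square algebra_simps)
  qed simp
  also have "\<dots> = (X ^ 2) ^ 2 ^ m + (c ^ 2) ^ 2 ^ m"
  proof (rule step.IH)
    show "t (2 * a) ^ 2 = t (2 * (2 * a)) + 2" for a by (rule step.prems(1))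
    show "t (2 * (2 ^ m - a)) = - t (2 * a)" if "a \<le> 2 ^ m" for a
      using step.prems(2)[of "2 * a"] that by (simp add: diff_mult_distrib2)
  qed
  finally show ?case by (simp flip: power_mult)
qed

lemma field_embedding_uminus:
  assumes "field_embedding \<iota>"
  shows "\<iota> (- x) = - \<iota> x"
proof -
  have add: "\<iota> (y + z) = \<iota> y + \<iota> z" for y z using assms by (simp add: field_embedding_def)
  have "\<iota> 0 = 0" using add[of 0 0] by (metis add_0 add_cancel_right_right)
  then show ?thesis using add[of "- x" x] by (simp add: eq_neg_iff_add_eq_0)
qed

text \<open>The constant \<open>2 s\<close> is twice the norm \<open>x\<^sup>q\<^sup>+\<^sup>1\<close> of \<open>x\<close>, taken in the smaller field. Norm 1 gives
  the doubling rule of \<open>half_trace_product\<close>; norm \<open>- 1\<close> gives the same rule with the opposite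
  sign.\<close>

lemma quadratic_trace_double:
  fixes \<iota> :: "'a::finite_field \<Rightarrow> 'b::finite_field"
  assumes emb: "field_embedding \<iota>" and pp: "primepow CARD('a)" and card: "CARD('b) = CARD('a) ^ 2"
    and norm: "x ^ (CARD('a) + 1) = \<iota> s"
  shows "quadratic_trace \<iota> x ^ 2 = quadratic_trace \<iota> (x ^ 2) + 2 * s"
proof (rule injD[OF field_embedding_inj[OF emb]])
  note tr = field_embedding_quadratic_trace[OF emb pp card]
  have hom: "\<iota> (y + z) = \<iota> y + \<iota> z" "\<iota> (y * z) = \<iota> y * \<iota> z" for y z
    using emb by (auto simp: field_embedding_def)
  have "\<iota> (quadratic_trace \<iota> x ^ 2) = (x + x ^ CARD('a)) ^ 2"
    by (simp add: power2_eq_square hom tr)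
  also have "\<dots> = x ^ 2 + (x ^ CARD('a)) ^ 2 + 2 * x ^ (CARD('a) + 1)"
    by (simp add: power2_eq_square algebra_simps)
  also have "\<dots> = \<iota> (quadratic_trace \<iota> (x ^ 2) + 2 * s)"
    by (simp only: hom tr norm mult_2 power_swap[of x "CARD('a)"])
  finally show "\<iota> (quadratic_trace \<iota> x ^ 2) = \<iota> (quadratic_trace \<iota> (x ^ 2) + 2 * s)" .
qed

lemma quadratic_trace_minus_conjugate:
  fixes \<iota> :: "'a::finite_field \<Rightarrow> 'b::finite_field"
  assumes emb: "field_embedding \<iota>" and pp: "primepow CARD('a)" and card: "CARD('b) = CARD('a) ^ 2"
    and odd: "odd CARD('a)"
  shows "quadratic_trace \<iota> (- (x ^ CARD('a))) = - quadratic_trace \<iota> x"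
proof (rule injD[OF field_embedding_inj[OF emb]])
  note tr = field_embedding_quadratic_trace[OF emb pp card]
  note minus = field_embedding_uminus[OF emb]
  have "(x ^ CARD('a)) ^ CARD('a) = x"
    using finite_field_power_card_eq_same[of x] card by (simp add: power2_eq_square power_mult)
  then show "\<iota> (quadratic_trace \<iota> (- (x ^ CARD('a)))) = \<iota> (- quadratic_trace \<iota> x)"
    using odd by (simp add: tr minus power_minus_odd)
qed

text \<open>Norm 1 means \<open>\<zeta>\<^sup>q = \<zeta>\<^sup>-\<^sup>1\<close>, so the traces of the powers of \<open>\<zeta>\<close> are a sequence as in
  \<open>half_trace_product\<close>.\<close>

lemma quadratic_trace_product:
  fixes \<iota> :: "'a::finite_field \<Rightarrow> 'b::finite_field" and c :: 'a
  assumes emb: "field_embedding \<iota>" and pp: "primepow CARD('a)" and card: "CARD('b) = CARD('a) ^ 2"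
    and odd: "odd CARD('a)" and two: "(2::'a) \<noteq> 0" and m: "m \<ge> 1"
    and norm: "\<zeta> ^ (CARD('a) + 1) = 1" and root: "\<zeta> ^ 2 ^ m = - 1"
  shows "(\<Prod>i\<in>{1..2 ^ (m - 1)}. Polynomial.monom 1 (2 * M)
            - Polynomial.monom (c * quadratic_trace \<iota> (\<zeta> ^ (2 * i - 1))) M + [:c ^ 2:])
       = Polynomial.monom 1 (2 ^ m * M) + [:c ^ 2 ^ m:]"
proof -
  define t where "t a = quadratic_trace \<iota> (\<zeta> ^ a)" for a
  have double: "t a ^ 2 = t (2 * a) + 2" for a
  proof -
    have "(\<zeta> ^ a) ^ (CARD('a) + 1) = (\<zeta> ^ (CARD('a) + 1)) ^ a"
      by (rule power_swap)
    then have "(\<zeta> ^ a) ^ (CARD('a) + 1) = \<iota> 1"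
      using emb norm by (simp add: field_embedding_def)
    from quadratic_trace_double[OF emb pp card this] show ?thesis
      by (simp add: t_def mult.commute[of 2] power_mult)
  qed
  have reflect: "t (2 ^ m - a) = - t a" if "a \<le> 2 ^ m" for a
  proof -
    have "\<zeta> ^ (2 ^ m - a) * \<zeta> ^ a = - 1" using that root by (simp flip: power_add)
    moreover have "- ((\<zeta> ^ a) ^ CARD('a)) * \<zeta> ^ a = - ((\<zeta> ^ (CARD('a) + 1)) ^ a)"
      by (simp add: power_add power_mult_distrib power_swap[of \<zeta> a] mult.commute)
    ultimately have "\<zeta> ^ (2 ^ m - a) * \<zeta> ^ a = - ((\<zeta> ^ a) ^ CARD('a)) * \<zeta> ^ a"
      using norm by simp
    moreover have "\<zeta> ^ a \<noteq> 0" using norm by auto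
    ultimately have "\<zeta> ^ (2 ^ m - a) = - ((\<zeta> ^ a) ^ CARD('a))"
      by (simp only: mult_cancel_right simp_thms)
    then show ?thesis by (simp add: t_def quadratic_trace_minus_conjugate[OF emb pp card odd])
  qed
  define X :: "'a poly" where "X = Polynomial.monom 1 M"
  have "[:2::'a:] \<noteq> 0" using two by (simp only: pCons_eq_0_iff simp_thms)
  then have "(2::'a poly) \<noteq> 0" by (simp add: numeral_poly)
  moreover have "[:t a:] ^ 2 = [:t (2 * a):] + 2" for a
    using double[of a] by (simp add: poly_const_pow numeral_poly)
  ultimately have "(\<Prod>i\<in>{1..2 ^ (m - 1)}. X ^ 2 - [:c:] * [:t (2 * i - 1):] * X + [:c:] ^ 2)
      = X ^ 2 ^ m + [:c:] ^ 2 ^ m"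
    using m reflect by (intro half_trace_product[where t = "\<lambda>a. [:t a:]"]) simp_all
  moreover have "X ^ k = Polynomial.monom 1 (k * M)" for k
    by (simp add: X_def monom_power mult.commute)
  moreover have "[:c:] * [:b:] * X = Polynomial.monom (c * b) M" for b
    by (simp add: X_def smult_monom)
  ultimately show ?thesis by (simp only: t_def poly_const_pow)
qed

text \<open>For norm \<open>- 1\<close> and odd \<open>a\<close> the trace is \<open>s = \<zeta>\<^sup>a - \<zeta>\<^sup>-\<^sup>a\<close>, and \<open>s\<^sup>2 + 2\<close> is the trace of
  \<open>\<zeta>\<^sup>2\<^sup>a\<close>. With \<open>Y = X\<^sup>M\<close>, multiplying the two signs gives
  \<open>(Y\<^sup>2 + c s Y - c\<^sup>2) (Y\<^sup>2 - c s Y - c\<^sup>2) = Y\<^sup>4 - c\<^sup>2 (s\<^sup>2 + 2) Y\<^sup>2 + c\<^sup>4\<close>, which is the factor of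
  the norm 1 case for \<open>\<zeta>\<^sup>2\<close>, \<open>c\<^sup>2\<close> and \<open>Y\<^sup>2\<close>.\<close>

lemma quadratic_trace_product_norm_minus_one:
  fixes \<iota> :: "'a::finite_field \<Rightarrow> 'b::finite_field" and c :: 'a
  assumes emb: "field_embedding \<iota>" and pp: "primepow CARD('a)" and card: "CARD('b) = CARD('a) ^ 2"
    and odd: "odd CARD('a)" and two: "(2::'a) \<noteq> 0" and m: "m \<ge> 1"
    and norm: "\<zeta> ^ (CARD('a) + 1) = - 1" and root: "\<zeta> ^ 2 ^ (m + 1) = - 1"
  shows "(\<Prod>i\<in>{1..2 ^ (m - 1)}.
            (Polynomial.monom 1 (2 * M)
               + Polynomial.monom (c * quadratic_trace \<iota> (\<zeta> ^ (2 * i - 1))) M - [:c ^ 2:])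
          * (Polynomial.monom 1 (2 * M)
               - Polynomial.monom (c * quadratic_trace \<iota> (\<zeta> ^ (2 * i - 1))) M - [:c ^ 2:]))
       = Polynomial.monom 1 (2 ^ (m + 1) * M) + [:c ^ 2 ^ (m + 1):]"
proof -
  have minus_one: "\<iota> (- 1) = - 1"
  proof -
    have "\<iota> 1 = 1" using emb by (simp only: field_embedding_def)
    then show ?thesis by (simp only: field_embedding_uminus[OF emb])
  qed
  have doubled: "(\<Prod>i\<in>{1..2 ^ (m - 1)}. Polynomial.monom 1 (2 * (2 * M))
            - Polynomial.monom (c ^ 2 * quadratic_trace \<iota> ((\<zeta> ^ 2) ^ (2 * i - 1))) (2 * M) + [:(c ^ 2) ^ 2:])
       = Polynomial.monom 1 (2 ^ m * (2 * M)) + [:(c ^ 2) ^ 2 ^ m:]"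
  proof (rule quadratic_trace_product[OF emb pp card odd two m])
    show "(\<zeta> ^ 2) ^ (CARD('a) + 1) = 1"
      using norm by (simp only: power_swap[of \<zeta> 2]) simp
    show "(\<zeta> ^ 2) ^ 2 ^ m = - 1" using root by (simp flip: power_mult)
  qed
  have factor: "Polynomial.monom 1 (2 * (2 * M))
            - Polynomial.monom (c ^ 2 * quadratic_trace \<iota> ((\<zeta> ^ 2) ^ (2 * i - 1))) (2 * M) + [:(c ^ 2) ^ 2:]
      = (Polynomial.monom 1 (2 * M)
               + Polynomial.monom (c * quadratic_trace \<iota> (\<zeta> ^ (2 * i - 1))) M - [:c ^ 2:])
          * (Polynomial.monom 1 (2 * M)
               - Polynomial.monom (c * quadratic_trace \<iota> (\<zeta> ^ (2 * i - 1))) M - [:c ^ 2:])"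
    if "i \<in> {1..2 ^ (m - 1)}" for i
  proof -
    define t where "t = quadratic_trace \<iota> (\<zeta> ^ (2 * i - 1))"
    have "(\<zeta> ^ (2 * i - 1)) ^ (CARD('a) + 1) = (\<zeta> ^ (CARD('a) + 1)) ^ (2 * i - 1)"
      by (rule power_swap)
    also have "\<dots> = \<iota> (- 1)" using that by (simp only: norm minus_one) (simp add: power_minus_odd)
    finally have "t ^ 2 = quadratic_trace \<iota> ((\<zeta> ^ (2 * i - 1)) ^ 2) + 2 * (- 1)"
      unfolding t_def by (rule quadratic_trace_double[OF emb pp card])
    then have t2: "quadratic_trace \<iota> ((\<zeta> ^ 2) ^ (2 * i - 1)) = t ^ 2 + 2"
      by (simp only: power_swap[of \<zeta> 2 "2 * i - 1"]) simp
    define X :: "'a poly" where "X = Polynomial.monom 1 M"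
    have X: "Polynomial.monom 1 (2 * M) = X ^ 2" "Polynomial.monom 1 (2 * (2 * M)) = (X ^ 2) ^ 2"
       "Polynomial.monom a M = [:a:] * X" "Polynomial.monom a (2 * M) = [:a:] * X ^ 2" for a
      by (simp_all add: X_def monom_power smult_monom mult_ac)
    have C: "[:a ^ k:] = [:a:] ^ k" "[:a * b:] = [:a:] * [:b:]" "[:a + b:] = [:a:] + [:b:]"
      "[:2::'a:] = 2" "[:1::'a:] = 1" for a b :: 'a and k
      by (simp_all add: poly_const_pow numeral_poly one_pCons)
    have "(X ^ 2) ^ 2 - C ^ 2 * (s ^ 2 + 2) * X ^ 2 + (C ^ 2) ^ 2
        = (1 * X ^ 2 + C * s * X - C ^ 2) * (1 * X ^ 2 - C * s * X - C ^ 2)" for C s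
      by (simp add: power2_eq_square algebra_simps)
    then show ?thesis unfolding t2 t_def[symmetric] X C .
  qed
  have "2 ^ m * (2 * M) = 2 ^ (m + 1) * M" and "(c ^ 2) ^ 2 ^ m = c ^ 2 ^ (m + 1)"
    by (simp_all flip: power_mult)
  note doubled = doubled[unfolded this]
  show ?thesis
    unfolding doubled[symmetric] by (rule prod.cong[OF refl]) (rule factor[symmetric])
qed

section \<open>Products over the powers of a root of unity of odd order\<close>

lemma primitive_root_of_unity_power_mod:
  assumes "primitive_root_of_unity d \<gamma>"
  shows "\<gamma> ^ (j mod d) = \<gamma> ^ j"
proof -
  have "\<gamma> ^ j = \<gamma> ^ (d * (j div d) + j mod d)" by simp
  also have "\<dots> = \<gamma> ^ (j mod d)"
    using assms by (simp only: power_add power_mult primitive_root_of_unity_def) simp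
  finally show ?thesis by simp
qed

lemma primitive_root_of_unity_inj_on:
  fixes \<gamma> :: "'a::field"
  assumes "primitive_root_of_unity d \<gamma>"
  shows "inj_on (\<lambda>j. \<gamma> ^ j) {0..<d}"
proof (rule linorder_inj_onI)
  fix i j assume ij: "i < j" "i \<in> {0..<d}" "j \<in> {0..<d}"
  have "\<gamma> \<noteq> 0" using assms by (auto simp: primitive_root_of_unity_def zero_power)
  moreover have "\<gamma> ^ j = \<gamma> ^ i * \<gamma> ^ (j - i)" using ij by (simp flip: power_add)
  moreover have "\<gamma> ^ (j - i) \<noteq> 1" using assms ij by (auto simp: primitive_root_of_unity_def)
  ultimately show "\<gamma> ^ i \<noteq> \<gamma> ^ j" by simp
qed auto

lemma monom_minus_one_eq_prod_linear:
  fixes \<gamma> :: "'a::field"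
  assumes prim: "primitive_root_of_unity d \<gamma>"
  shows "Polynomial.monom 1 d - 1 = (\<Prod>j\<in>{0..<d}. [:- (\<gamma> ^ j), 1:])"
proof -
  have d: "d > 0" "\<gamma> ^ d = 1" using prim by (auto simp: primitive_root_of_unity_def)
  define P where "P = Polynomial.monom 1 d - 1 - (\<Prod>j\<in>{0..<d}. [:- (\<gamma> ^ j), 1:])"
  have deg: "Polynomial.degree (\<Prod>j\<in>{0..<d}. [:- (\<gamma> ^ j), 1:]) = d"
    by (subst degree_prod_eq_sum_degree) auto
  have "lead_coeff (\<Prod>j\<in>{0..<d}. [:- (\<gamma> ^ j), 1:]) = 1"
    by (simp add: lead_coeff_prod)
  then have "Polynomial.coeff P d = 0" using d(1) by (simp add: P_def deg)
  moreover have "Polynomial.degree P \<le> d"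
    unfolding P_def using deg by (intro degree_diff_le) (auto simp: degree_monom_le)
  ultimately have less: "P = 0 \<or> Polynomial.degree P < d" by (metis eq_zero_or_degree_less)
  have "P = 0"
  proof (rule ccontr)
    assume P: "P \<noteq> 0"
    have "(\<lambda>j. \<gamma> ^ j) ` {0..<d} \<subseteq> {x. poly P x = 0}"
    proof (rule image_subsetI)
      fix j assume "j \<in> {0..<d}"
      then have "poly (\<Prod>i\<in>{0..<d}. [:- (\<gamma> ^ i), 1:]) (\<gamma> ^ j) = 0"
        unfolding poly_prod by (intro prod_zero) auto
      then show "\<gamma> ^ j \<in> {x. poly P x = 0}"
        using d(2) by (simp add: P_def poly_monom power_swap[of \<gamma> j d])
    qed
    then have "card ((\<lambda>j. \<gamma> ^ j) ` {0..<d}) \<le> card {x. poly P x = 0}"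
      by (intro card_mono poly_roots_finite P)
    also have "\<dots> \<le> Polynomial.degree P" by (rule card_poly_roots_bound[OF P])
    finally show False
      using less P by (simp add: card_image primitive_root_of_unity_inj_on[OF prim])
  qed
  then show ?thesis by (simp add: P_def)
qed

lemma monom_mult_minus_one_eq_prod:
  fixes \<gamma> :: "'a::field"
  assumes prim: "primitive_root_of_unity d \<gamma>"
  shows "Polynomial.monom 1 (N * d) - 1 = (\<Prod>j\<in>{0..<d}. Polynomial.monom 1 N - [:\<gamma> ^ j:])"
proof -
  have "pcompose (\<Prod>j\<in>{0..<d}. [:0, 1 :: 'a:]) (Polynomial.monom 1 N) = Polynomial.monom 1 (N * d)"
    unfolding pcompose_prod by (simp add: pcompose_pCons monom_power mult.commute)
  then have "pcompose (Polynomial.monom 1 d - 1) (Polynomial.monom 1 N :: 'a poly)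
      = Polynomial.monom 1 (N * d) - 1"
    by (simp add: pcompose_diff pcompose_1 monom_altdef)
  moreover have "pcompose [:- b, 1:] (Polynomial.monom 1 N) = Polynomial.monom 1 N - [:b:]" for b :: 'a
    by (simp add: pcompose_pCons)
  ultimately show ?thesis
    by (simp only: monom_minus_one_eq_prod_linear[OF prim] pcompose_prod)
qed

text \<open>Doubling permutes the residues modulo an odd \<open>d\<close>, and also the nonzero ones. The lower bound
  \<open>a\<close> covers both index sets: \<open>a = 0\<close> gives all powers of \<open>\<gamma>\<close>, and \<open>a = 1\<close> leaves out the
  power 1.\<close>

lemma prod_primitive_root_powers_square:
  fixes \<gamma> :: "'a::field" and f :: "'a \<Rightarrow> 'c::comm_monoid_mult"
  assumes prim: "primitive_root_of_unity d \<gamma>" and odd: "odd d" and a: "a \<le> 1"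
  shows "(\<Prod>j\<in>{a..<d}. f ((\<gamma> ^ j) ^ 2)) = (\<Prod>j\<in>{a..<d}. f (\<gamma> ^ j))"
proof -
  let ?h = "\<lambda>j. (2 * j) mod d"
  have inj: "inj_on ?h {a..<d}"
  proof (rule inj_onI)
    fix i j assume ij: "i \<in> {a..<d}" "j \<in> {a..<d}" "?h i = ?h j"
    then have "[2 * i = 2 * j] (mod d)" by (simp add: cong_def)
    then have "[i = j] (mod d)" using odd by (subst (asm) cong_mult_lcancel_nat) auto
    with ij show "i = j" by (simp add: cong_def)
  qed
  moreover have "?h ` {a..<d} \<subseteq> {a..<d}"
  proof
    fix x assume "x \<in> ?h ` {a..<d}"
    then obtain j where j: "j \<in> {a..<d}" "x = ?h j" by auto
    have "a \<le> x"
    proof (cases "a = 0")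
      case False
      have "\<not> d dvd 2 * j"
      proof
        assume "d dvd 2 * j"
        then have "d dvd j" using odd by (subst (asm) coprime_dvd_mult_right_iff) auto
        with j False show False by (auto dest: dvd_imp_le)
      qed
      then show ?thesis using a j by (simp add: dvd_eq_mod_eq_0)
    qed simp
    moreover have "x < d" using j by auto
    ultimately show "x \<in> {a..<d}" by simp
  qed
  ultimately have "bij_betw ?h {a..<d} {a..<d}" by (simp add: bij_betw_def endo_inj_surj)
  from prod.reindex_bij_betw[OF this, of "\<lambda>j. f (\<gamma> ^ j)"]
  have "(\<Prod>j\<in>{a..<d}. f (\<gamma> ^ ?h j)) = (\<Prod>j\<in>{a..<d}. f (\<gamma> ^ j))" .
  then show ?thesis
    by (simp add: primitive_root_of_unity_power_mod[OF prim] mult.commute[of 2] power_mult)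
qed

lemma prod_primitive_root_powers_power_two:
  fixes \<gamma> :: "'a::field" and f :: "'a \<Rightarrow> 'c::comm_monoid_mult"
  assumes "primitive_root_of_unity d \<gamma>" and "odd d" and "a \<le> 1"
  shows "(\<Prod>j\<in>{a..<d}. f ((\<gamma> ^ j) ^ 2 ^ m)) = (\<Prod>j\<in>{a..<d}. f (\<gamma> ^ j))"
proof (induction m)
  case (Suc m)
  then show ?case
    using prod_primitive_root_powers_square[OF assms, of "\<lambda>x. f (x ^ 2 ^ m)"]
    by (simp add: power_mult)
qed simp

text \<open>For a single \<open>j\<close> the product \<open>(X\<^sup>N - \<gamma>\<^sup>j) (X\<^sup>N + \<gamma>\<^sup>j) = X\<^sup>2\<^sup>N - \<gamma>\<^sup>2\<^sup>j\<close> has the wrong constant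
  term for the next step; in the product over all \<open>j\<close> the squares can be permuted back.\<close>

lemma prod_primitive_root_powers_telescope:
  fixes \<gamma> :: "'a::field"
  assumes "primitive_root_of_unity d \<gamma>" and "odd d" and "a \<le> 1"
  shows "(\<Prod>j\<in>{a..<d}. Polynomial.monom 1 N - [:\<gamma> ^ j:])
          * (\<Prod>e\<in>{0..<l}. \<Prod>j\<in>{a..<d}. Polynomial.monom 1 (2 ^ e * N) + [:\<gamma> ^ j:])
       = (\<Prod>j\<in>{a..<d}. Polynomial.monom 1 (2 ^ l * N) - [:\<gamma> ^ j:])"
proof (induction l)
  case (Suc l)
  let ?X = "Polynomial.monom 1 (2 ^ l * N) :: 'a poly"
  have "(\<Prod>j\<in>{a..<d}. ?X - [:\<gamma> ^ j:]) * (\<Prod>j\<in>{a..<d}. ?X + [:\<gamma> ^ j:])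
      = (\<Prod>j\<in>{a..<d}. Polynomial.monom 1 (2 ^ Suc l * N) - [:(\<gamma> ^ j) ^ 2:])"
    unfolding prod.distrib[symmetric]
    by (rule prod.cong)
      (simp_all add: algebra_simps mult_monom power2_eq_square smult_monom flip: mult_2)
  also have "\<dots> = (\<Prod>j\<in>{a..<d}. Polynomial.monom 1 (2 ^ Suc l * N) - [:\<gamma> ^ j:])"
    by (rule prod_primitive_root_powers_square[OF assms])
  finally show ?case using Suc by (simp add: mult.assoc[symmetric])
qed simp

section \<open>Counting irreducible factors\<close>

definition irreducible_product :: "nat \<Rightarrow> 'a::comm_semiring_1 \<Rightarrow> bool" where
  "irreducible_product N p \<longleftrightarrow>
     (\<exists>F. size F = N \<and> (\<forall>f\<in>#F. Factorial_Ring.irreducible f) \<and> p = prod_mset F)"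

lemma irreducible_product_irreducible:
  "Factorial_Ring.irreducible p \<Longrightarrow> irreducible_product 1 p"
  unfolding irreducible_product_def by (intro exI[of _ "{#p#}"]) simp

lemma irreducible_product_mult:
  assumes "irreducible_product M p" and "irreducible_product N r"
  shows "irreducible_product (M + N) (p * r)"
proof -
  from assms obtain F G where "size F = M" "\<forall>f\<in>#F. Factorial_Ring.irreducible f" "p = prod_mset F"
    "size G = N" "\<forall>f\<in>#G. Factorial_Ring.irreducible f" "r = prod_mset G"
    unfolding irreducible_product_def by blast
  then show ?thesis unfolding irreducible_product_def by (intro exI[of _ "F + G"]) auto
qed

lemma irreducible_product_prod:
  assumes "finite A" and "\<And>x. x \<in> A \<Longrightarrow> irreducible_product (N x) (f x)"
  shows "irreducible_product (\<Sum>x\<in>A. N x) (\<Prod>x\<in>A. f x)"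
  using assms
proof (induction A rule: finite_induct)
  case empty
  show ?case unfolding irreducible_product_def by (intro exI[of _ "{#}"]) simp
next
  case (insert x A)
  then show ?case using irreducible_product_mult[of "N x" "f x"] by simp
qed

section \<open>The factorization\<close>

lemma primitive_root_of_unity_half_power:
  assumes "primitive_root_of_unity (2 ^ k) x" and "k \<ge> 1"
  shows "x ^ 2 ^ (k - 1) = - 1"
proof -
  have k: "(2::nat) ^ k = 2 ^ (k - 1) * 2" using assms(2) by (cases k) auto
  have "(x ^ 2 ^ (k - 1)) ^ 2 = 1"
    using assms(1) unfolding primitive_root_of_unity_def k by (simp only: power_mult)
  moreover have "x ^ 2 ^ (k - 1) \<noteq> 1"
    using assms(1) unfolding primitive_root_of_unity_def k by simp
  ultimately show ?thesis by (simp add: power2_eq_1_iff)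
qed

lemma two_neq_zero_if_odd_card:
  assumes "odd CARD('a::finite_field)"
  shows "(2::'a) \<noteq> 0"
proof
  assume "(2::'a) = 0"
  then have "of_nat 2 = (0::'a)" by simp
  then have "CHAR('a) dvd 2" by (simp only: of_nat_eq_0_iff_char_dvd)
  then have "CHAR('a) = 2"
    using CHAR_prime[where ?'a = 'a] two_is_prime_nat primes_dvd_imp_eq by blast
  then show False using CHAR_dvd_CARD[where ?'a = 'a] assms by simp
qed

text \<open>The factors over a fixed \<open>j\<close> multiply to binomials \<open>X^(2^e) + c^(2^l)\<close> with \<open>c = \<gamma>\<^sup>j\<close>. In the
  product over \<open>j\<close> the exponent \<open>2^l\<close> can be dropped, so one is left with one block
  \<open>\<Prod>\<^sub>j (X^(2^e) + \<gamma>\<^sup>j)\<close> for each \<open>e\<close> from 1 to \<open>n - 1\<close>: those with \<open>e < u - 1\<close> come from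
  \<open>G\<close> (with \<open>e = k - 1\<close>), the others from \<open>H\<close> (with \<open>e = u - 1 + r\<close>). Together with the linear
  factors, which give \<open>\<Prod>\<^sub>j (X\<^sup>2 - \<gamma>\<^sup>j)\<close>, they telescope.\<close>

lemma prod_factors_eq:
  fixes \<gamma> :: "'a::field" and G H :: "nat \<Rightarrow> nat \<Rightarrow> 'a \<Rightarrow> 'a poly"
  assumes prim: "primitive_root_of_unity d \<gamma>" and odd: "odd d" and a: "a \<le> 1"
    and u: "u \<ge> 2" "n \<ge> u"
    and G: "\<And>k c. k \<in> {2..u - 1} \<Longrightarrow>
      (\<Prod>i\<in>I k. G k i c) = Polynomial.monom 1 (2 ^ (k - 1)) + [:c ^ 2 ^ (k - 1):]"
    and H: "\<And>r c. (\<Prod>i\<in>J. H r i c) = Polynomial.monom 1 (2 ^ (u - 1) * 2 ^ r) + [:c ^ 2 ^ (u - 1):]"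
  shows "(\<Prod>j\<in>{a..<d}. [:\<gamma> ^ j, 1:] * [:- (\<gamma> ^ j), 1:])
       * (\<Prod>k\<in>{2..u - 1}. \<Prod>i\<in>I k. \<Prod>j\<in>{a..<d}. G k i (\<gamma> ^ j))
       * (\<Prod>r\<in>{0..n - u}. \<Prod>i\<in>J. \<Prod>j\<in>{a..<d}. H r i (\<gamma> ^ j))
       = (\<Prod>j\<in>{a..<d}. Polynomial.monom 1 (2 ^ n) - [:\<gamma> ^ j:])" (is "?A * ?B * ?C = _")
proof -
  define P where "P N = (\<Prod>j\<in>{a..<d}. Polynomial.monom 1 N + [:\<gamma> ^ j:])" for N
  note reindex = prod_primitive_root_powers_power_two[OF prim odd a]
  have "?A = (\<Prod>j\<in>{a..<d}. Polynomial.monom 1 2 - [:(\<gamma> ^ j) ^ 2:])"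
    by (rule prod.cong) (simp_all add: power2_eq_square monom_altdef)
  also have "\<dots> = (\<Prod>j\<in>{a..<d}. Polynomial.monom 1 2 - [:\<gamma> ^ j:])"
    by (rule prod_primitive_root_powers_square[OF prim odd a])
  finally have A: "?A = (\<Prod>j\<in>{a..<d}. Polynomial.monom 1 2 - [:\<gamma> ^ j:])" .
  have "?B = (\<Prod>k\<in>{2..u - 1}. P (2 ^ (k - 1)))"
  proof (rule prod.cong)
    fix k assume k: "k \<in> {2..u - 1}"
    have "(\<Prod>i\<in>I k. \<Prod>j\<in>{a..<d}. G k i (\<gamma> ^ j)) = (\<Prod>j\<in>{a..<d}. \<Prod>i\<in>I k. G k i (\<gamma> ^ j))"
      by (rule prod.swap)
    also have "\<dots> = P (2 ^ (k - 1))" unfolding G[OF k] P_def by (rule reindex)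
    finally show "(\<Prod>i\<in>I k. \<Prod>j\<in>{a..<d}. G k i (\<gamma> ^ j)) = P (2 ^ (k - 1))" .
  qed simp
  also have "\<dots> = (\<Prod>e\<in>{0..<u - 2}. P (2 ^ e * 2))"
  proof (rule prod.reindex_bij_witness[of _ "\<lambda>e. e + 2" "\<lambda>k. k - 2"])
    fix k assume "k \<in> {2..u - 1}"
    then obtain e where "k = e + 2" by (metis atLeastAtMost_iff add.commute le_Suc_ex)
    then show "P (2 ^ (k - 2) * 2) = P (2 ^ (k - 1))" by (simp add: mult.commute)
  qed auto
  finally have B: "?B = (\<Prod>e\<in>{0..<u - 2}. P (2 ^ e * 2))" .
  have "?C = (\<Prod>r\<in>{0..n - u}. P (2 ^ (u - 1) * 2 ^ r))"
  proof (rule prod.cong)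
    fix r
    have "(\<Prod>i\<in>J. \<Prod>j\<in>{a..<d}. H r i (\<gamma> ^ j)) = (\<Prod>j\<in>{a..<d}. \<Prod>i\<in>J. H r i (\<gamma> ^ j))"
      by (rule prod.swap)
    also have "\<dots> = P (2 ^ (u - 1) * 2 ^ r)" unfolding H P_def by (rule reindex)
    finally show "(\<Prod>i\<in>J. \<Prod>j\<in>{a..<d}. H r i (\<gamma> ^ j)) = P (2 ^ (u - 1) * 2 ^ r)" .
  qed simp
  also have "\<dots> = (\<Prod>e\<in>{u - 2..<n - 1}. P (2 ^ e * 2))"
  proof (rule prod.reindex_bij_witness[of _ "\<lambda>e. e - (u - 2)" "\<lambda>r. r + (u - 2)"])
    fix r
    have "2 ^ (r + (u - 2)) * 2 = (2 ^ Suc (r + (u - 2)) :: nat)" by simp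
    also have "Suc (r + (u - 2)) = (u - 1) + r" using u by simp
    finally show "P (2 ^ (r + (u - 2)) * 2) = P (2 ^ (u - 1) * 2 ^ r)" by (simp only: power_add)
  qed (use u in auto)
  finally have C: "?C = (\<Prod>e\<in>{u - 2..<n - 1}. P (2 ^ e * 2))" .
  have "?B * ?C = (\<Prod>e\<in>{0..<n - 1}. P (2 ^ e * 2))"
    unfolding B C by (rule prod.atLeastLessThan_concat) (use u in auto)
  then have "?A * ?B * ?C = (\<Prod>j\<in>{a..<d}. Polynomial.monom 1 (2 ^ (n - 1) * 2) - [:\<gamma> ^ j:])"
    unfolding mult.assoc A P_def
    by (simp only: prod_primitive_root_powers_telescope[OF prim odd a])
  also have "2 ^ (n - 1) * 2 = (2::nat) ^ n" using u by (cases n) auto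
  finally show ?thesis .
qed

text \<open>The summands 1 and \<open>1 + 1\<close> are the numbers of factors written for one index tuple.\<close>

lemma factor_count:
  fixes d u n :: nat
  assumes "u \<ge> 3" and "n \<ge> u"
  shows "(\<Sum>j\<in>{0..<d}. 1 + 1) + (\<Sum>k\<in>{2..u - 1}. \<Sum>i\<in>{1..2 ^ (k - 2)::nat}. \<Sum>j\<in>{0..<d}. 1)
       + (\<Sum>r\<in>{0..n - u}. \<Sum>i\<in>{1..2 ^ (u - 3)::nat}. \<Sum>j\<in>{0..<d}. 1 + 1)
       = d * (2 ^ (u - 2) * (n - u + 2) + 1)"
proof -
  have geom: "(\<Sum>k\<in>{2..x + 2}. 2 ^ (k - 2)) + 1 = (2::nat) ^ (x + 1)" for x
    by (induction x) auto
  obtain x where x: "u = x + 3" using assms(1) by (metis add.commute le_Suc_ex)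
  have "(\<Sum>k\<in>{2..u - 1}. \<Sum>i\<in>{1..2 ^ (k - 2)::nat}. \<Sum>j\<in>{0..<d}. 1) = (\<Sum>k\<in>{2..x + 2}. 2 ^ (k - 2)) * d"
    by (simp add: x flip: sum_distrib_right)
  moreover have "(\<Sum>k\<in>{2..x + 2}. 2 ^ (k - 2)) * d + d = 2 ^ (x + 1) * d"
    using geom[of x] by (metis add_mult_distrib mult_1)
  ultimately show ?thesis by (simp add: x algebra_simps)
qed

theorem theorem3p6:
  fixes \<iota> :: "'a::finite_field \<Rightarrow> 'b::finite_field"
    and q u v d n :: nat
    and \<beta> :: "nat \<Rightarrow> 'b"
    and \<gamma> :: 'a
  assumes "primepow q" and "q mod 4 = 3"
    and "CARD('a) = q" and "CARD('b) = q ^ 2" and "field_embedding \<iota>"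
    and "q ^ 2 = 2 ^ u * v + 1" and "odd v"
    and "\<forall>k\<le>u. primitive_root_of_unity (2 ^ k) (\<beta> (2 ^ k))"
    and "d > 0" and "odd d" and "d dvd q - 1"
    and "primitive_root_of_unity d \<gamma>"
    and "n \<ge> u"
  shows
    "(\<exists>F :: 'a poly multiset.
        size F = d * (2 ^ (u - 2) * (n - u + 2) + 1) \<and>
        (\<forall>f\<in>#F. Factorial_Ring.irreducible f) \<and>
        Polynomial.monom 1 (2 ^ n * d) - 1 = prod_mset F)
     \<and>
     Polynomial.monom 1 (2 ^ n * d) - 1 =
       (Polynomial.monom 1 (2 ^ n) - 1)
       * (\<Prod>j\<in>{1..d - 1}. [: \<gamma> ^ j, 1 :] * [: - (\<gamma> ^ j), 1 :])
       * (\<Prod>k\<in>{2..u - 1}. \<Prod>i\<in>{1..2 ^ (k - 2)}. \<Prod>j\<in>{1..d - 1}.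
            [: \<gamma> ^ (2 * j), - (\<gamma> ^ j * quadratic_trace \<iota> (\<beta> (2 ^ k) ^ (2 * i - 1))), 1 :])
       * (\<Prod>r\<in>{0..n - u}. \<Prod>i\<in>{1..2 ^ (u - 3)}. \<Prod>j\<in>{1..d - 1}.
            (Polynomial.monom 1 (2 ^ (r + 1))
               + Polynomial.monom (\<gamma> ^ j * quadratic_trace \<iota> (\<beta> (2 ^ u) ^ (2 * i - 1))) (2 ^ r)
               - [: \<gamma> ^ (2 * j) :])
            * (Polynomial.monom 1 (2 ^ (r + 1))
               - Polynomial.monom (\<gamma> ^ j * quadratic_trace \<iota> (\<beta> (2 ^ u) ^ (2 * i - 1))) (2 ^ r)
               - [: \<gamma> ^ (2 * j) :]))
     \<and>
     (\<forall>j\<in>{1..d - 1}. Factorial_Ring.irreducible [: \<gamma> ^ j, 1 :] \<and> Factorial_Ring.irreducible [: - (\<gamma> ^ j), 1 :])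
     \<and>
     (\<forall>k\<in>{2..u - 1}. \<forall>i\<in>{1..2 ^ (k - 2)}. \<forall>j\<in>{1..d - 1}.
        Factorial_Ring.irreducible
          [: \<gamma> ^ (2 * j), - (\<gamma> ^ j * quadratic_trace \<iota> (\<beta> (2 ^ k) ^ (2 * i - 1))), 1 :])
     \<and>
     (\<forall>r\<in>{0..n - u}. \<forall>i\<in>{1..2 ^ (u - 3)}. \<forall>j\<in>{1..d - 1}.
        Factorial_Ring.irreducible
          (Polynomial.monom 1 (2 ^ (r + 1))
             + Polynomial.monom (\<gamma> ^ j * quadratic_trace \<iota> (\<beta> (2 ^ u) ^ (2 * i - 1))) (2 ^ r)
             - [: \<gamma> ^ (2 * j) :]) \<and>
        Factorial_Ring.irreducible
          (Polynomial.monom 1 (2 ^ (r + 1))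
             - Polynomial.monom (\<gamma> ^ j * quadratic_trace \<iota> (\<beta> (2 ^ u) ^ (2 * i - 1))) (2 ^ r)
             - [: \<gamma> ^ (2 * j) :]))"
proof -
  have emb: "field_embedding \<iota>" and pp: "primepow CARD('a)" and card: "CARD('b) = CARD('a) ^ 2"
    using assms by simp_all
  have q_odd: "odd CARD('a)" using assms(2,3) by presburger
  have two: "(2::'a) \<noteq> 0" by (rule two_neq_zero_if_odd_card[OF q_odd])
  obtain w where u: "u \<ge> 3" and w: "odd w" "q + 1 = 2 ^ (u - 1) * w"
    using split_power_two_factor[OF assms(2,6,7)] by blast
  have half: "\<beta> (2 ^ k) ^ 2 ^ (k - 1) = - 1" if "1 \<le> k" "k \<le> u" for k
    using assms(8) that by (intro primitive_root_of_unity_half_power) auto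
  have norm: "\<beta> (2 ^ k) ^ (CARD('a) + 1) = 1" if "k \<le> u - 1" for k
  proof -
    have "2 ^ k dvd CARD('a) + 1"
      unfolding assms(3) w(2) using that by (intro dvd_mult2 le_imp_power_dvd)
    moreover have "\<beta> (2 ^ k) ^ 2 ^ k = 1"
      using assms(8) that by (simp add: primitive_root_of_unity_def)
    ultimately show ?thesis by (metis dvdE power_mult power_one)
  qed
  have norm_u: "\<beta> (2 ^ u) ^ (CARD('a) + 1) = - 1"
    unfolding assms(3) w(2) power_mult using half[of u] u w(1) by simp

  (* G is the quadratic factor, Hp and Hm are the two factors with the sign written as plus-minus;
     the power of gamma is the parameter c, since only c^d = 1 matters for irreducibility. *)
  define T where "T k i = quadratic_trace \<iota> (\<beta> (2 ^ k) ^ (2 * i - 1))" for k i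
  define G where "G k i c = [:c ^ 2, - (c * T k i), 1:]" for k i and c :: 'a
  define Hp where "Hp r i c = Polynomial.monom 1 (2 ^ (r + 1)) + Polynomial.monom (c * T u i) (2 ^ r) - [:c ^ 2:]"
    for r i and c :: 'a
  define Hm where "Hm r i c = Polynomial.monom 1 (2 ^ (r + 1)) - Polynomial.monom (c * T u i) (2 ^ r) - [:c ^ 2:]"
    for r i and c :: 'a

  have prod_G: "(\<Prod>i\<in>{1..2 ^ (k - 2)}. G k i c) = Polynomial.monom 1 (2 ^ (k - 1)) + [:c ^ 2 ^ (k - 1):]"
    if k: "k \<in> {2..u - 1}" for k c
  proof -
    have "(\<Prod>i\<in>{1..2 ^ (k - 1 - 1)}. Polynomial.monom 1 (2 * 1)
            - Polynomial.monom (c * quadratic_trace \<iota> (\<beta> (2 ^ k) ^ (2 * i - 1))) 1 + [:c ^ 2:])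
       = Polynomial.monom 1 (2 ^ (k - 1) * 1) + [:c ^ 2 ^ (k - 1):]"
    proof (rule quadratic_trace_product[OF emb pp card q_odd two])
      show "1 \<le> k - 1" using k by auto
      show "\<beta> (2 ^ k) ^ (CARD('a) + 1) = 1" using k by (intro norm) auto
      show "\<beta> (2 ^ k) ^ 2 ^ (k - 1) = - 1" using k by (intro half) auto
    qed
    moreover have "G k i c = Polynomial.monom 1 (2 * 1) - Polynomial.monom (c * T k i) 1 + [:c ^ 2:]" for i
      by (simp add: G_def monom_altdef power2_eq_square)
    moreover have "k - 1 - 1 = k - 2" by simp
    ultimately show ?thesis unfolding T_def by (simp only: mult_1_right)
  qed
  have prod_H: "(\<Prod>i\<in>{1..2 ^ (u - 3)}. Hp r i c * Hm r i c)
      = Polynomial.monom 1 (2 ^ (u - 1) * 2 ^ r) + [:c ^ 2 ^ (u - 1):]" for r c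
  proof -
    have u': "u - 2 - 1 = u - 3" "u - 2 + 1 = u - 1" "2 * 2 ^ r = (2::nat) ^ (r + 1)" using u by auto
    have "\<beta> (2 ^ u) ^ 2 ^ (u - 2 + 1) = - 1" unfolding u' using u by (intro half) auto
    moreover have "1 \<le> u - 2" using u by simp
    ultimately show ?thesis
      using quadratic_trace_product_norm_minus_one[OF emb pp card q_odd two _ norm_u, of "u - 2" "2 ^ r" c]
      unfolding u' Hp_def Hm_def T_def by blast
  qed

  have root: "(c ^ k) ^ d = 1" if "c ^ d = 1" for c :: 'a and k
    using that by (subst power_swap) simp
  have irr_G: "Factorial_Ring.irreducible (G k i c)"
    if "k \<in> {2..u - 1}" "i \<in> {1..2 ^ (k - 2)}" "c ^ d = 1" for k i c
  proof (rule irreducible_if_dvd_binomial[OF two _ _ root[OF that(3)] assms(10)])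
    show "G k i c dvd Polynomial.monom 1 (2 ^ (k - 1)) + [:c ^ 2 ^ (k - 1):]"
      unfolding prod_G[OF that(1), symmetric] using that(2) by (intro dvd_prodI) auto
    show "Polynomial.degree (G k i c) > 0" by (simp add: G_def)
    fix e assume "2 ^ (k - 1 + 1) dvd CARD('a) ^ e - 1"
    moreover have "2 ^ 2 dvd (2::nat) ^ (k - 1 + 1)" using that(1) by (intro le_imp_power_dvd) auto
    ultimately have "4 dvd q ^ e - 1" using dvd_trans assms(3) by fastforce
    then show "Polynomial.degree (G k i c) dvd e"
      using dvd_power_diff_imp_even[OF assms(2)] by (simp add: G_def numeral_2_eq_2)
  qed
  have irr_H: "Factorial_Ring.irreducible F"
    if F: "F dvd Hp r i c * Hm r i c" "Polynomial.degree F = 2 ^ (r + 1)"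
      and "i \<in> {1..2 ^ (u - 3)}" "c ^ d = 1" for F r i c
  proof (rule irreducible_if_dvd_binomial[OF two _ _ root[OF that(4)] assms(10)])
    have "Hp r i c * Hm r i c dvd Polynomial.monom 1 (2 ^ (u - 1) * 2 ^ r) + [:c ^ 2 ^ (u - 1):]"
      unfolding prod_H[symmetric] using that(3) by (intro dvd_prodI) auto
    then show "F dvd Polynomial.monom 1 (2 ^ (u - 1 + r)) + [:c ^ 2 ^ (u - 1):]"
      using dvd_trans[OF F(1)] by (simp only: power_add)
    show "Polynomial.degree F > 0" by (simp add: F(2))
    fix e assume "2 ^ (u - 1 + r + 1) dvd CARD('a) ^ e - 1"
    moreover have "u - 1 + r + 1 = u + r" using u by simp
    ultimately show "Polynomial.degree F dvd e"
      unfolding F(2) using power_two_dvd_power_diff_imp_dvd_exponent[OF assms(2,6,7), of r e] u assms(3)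
      by simp
  qed
  have degree_H: "Polynomial.degree (Hp r i c) = 2 ^ (r + 1)" "Polynomial.degree (Hm r i c) = 2 ^ (r + 1)" for r i c
  proof -
    have "Polynomial.degree (Polynomial.monom 1 (2 ^ (r + 1)) + L) = 2 ^ (r + 1)"
      if "Polynomial.degree L \<le> 2 ^ r" for L :: "'a poly"
      using that by (subst degree_add_eq_left) (auto simp: degree_monom_eq le_less_trans)
    moreover have "Polynomial.degree (Polynomial.monom b (2 ^ r) - [:c ^ 2:]) \<le> 2 ^ r" for b
      by (intro degree_diff_le) (auto simp: degree_monom_le)
    moreover have "Hp r i c = Polynomial.monom 1 (2 ^ (r + 1)) + (Polynomial.monom (c * T u i) (2 ^ r) - [:c ^ 2:])"
      "Hm r i c = Polynomial.monom 1 (2 ^ (r + 1)) + (Polynomial.monom (- (c * T u i)) (2 ^ r) - [:c ^ 2:])"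
      by (simp_all add: Hp_def Hm_def minus_monom[symmetric])
    ultimately show "Polynomial.degree (Hp r i c) = 2 ^ (r + 1)" "Polynomial.degree (Hm r i c) = 2 ^ (r + 1)"
      by simp_all
  qed
  have irr_Hp: "Factorial_Ring.irreducible (Hp r i c)" and irr_Hm: "Factorial_Ring.irreducible (Hm r i c)"
    if "i \<in> {1..2 ^ (u - 3)}" "c ^ d = 1" for r i c
    by (rule irr_H[of _ r i c]; use that degree_H in simp)+

  have \<gamma>: "(\<gamma> ^ j) ^ d = 1" for j
    using assms(12) by (intro root) (simp add: primitive_root_of_unity_def)
  (* a = 1 is the displayed factorization; a = 0 includes the factors of X^(2^n) - 1, which gives
     the count. *)
  have product: "(\<Prod>j\<in>{a..<d}. [:\<gamma> ^ j, 1:] * [:- (\<gamma> ^ j), 1:])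
       * (\<Prod>k\<in>{2..u - 1}. \<Prod>i\<in>{1..2 ^ (k - 2)}. \<Prod>j\<in>{a..<d}. G k i (\<gamma> ^ j))
       * (\<Prod>r\<in>{0..n - u}. \<Prod>i\<in>{1..2 ^ (u - 3)}. \<Prod>j\<in>{a..<d}. Hp r i (\<gamma> ^ j) * Hm r i (\<gamma> ^ j))
       = (\<Prod>j\<in>{a..<d}. Polynomial.monom 1 (2 ^ n) - [:\<gamma> ^ j:])" if "a \<le> 1" for a
    using u by (intro prod_factors_eq[OF assms(12,10) that _ assms(13)] prod_G prod_H) auto
  have full: "Polynomial.monom 1 (2 ^ n * d) - 1 = (\<Prod>j\<in>{0..<d}. Polynomial.monom 1 (2 ^ n) - [:\<gamma> ^ j:])"
    by (rule monom_mult_minus_one_eq_prod[OF assms(12)])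
  have range: "{1..d - 1} = {1..<d}" using assms(9) by auto
  have pow: "\<gamma> ^ (2 * j) = (\<gamma> ^ j) ^ 2" for j by (simp only: mult.commute[of 2] power_mult)

  have "irreducible_product (d * (2 ^ (u - 2) * (n - u + 2) + 1)) (Polynomial.monom 1 (2 ^ n * d) - 1 :: 'a poly)"
    unfolding full product[of 0, OF zero_le_one, symmetric] factor_count[OF u assms(13), symmetric]
    by (intro irreducible_product_mult irreducible_product_prod irreducible_product_irreducible
        finite_atLeastAtMost finite_atLeastLessThan irr_G irr_Hp irr_Hm \<gamma> irreducible_linear_field_poly)
      auto
  moreover have "Polynomial.monom 1 (2 ^ n * d) - 1
      = (Polynomial.monom 1 (2 ^ n) - 1) * (\<Prod>j\<in>{1..<d}. Polynomial.monom 1 (2 ^ n) - [:\<gamma> ^ j:])"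
    unfolding full using assms(9) by (subst prod.atLeast_Suc_lessThan) (auto simp: one_pCons)
  moreover have "\<forall>j\<in>{1..<d}. Factorial_Ring.irreducible [:\<gamma> ^ j, 1:] \<and> Factorial_Ring.irreducible [:- (\<gamma> ^ j), 1:]"
    by (auto intro!: irreducible_linear_field_poly)
  ultimately show ?thesis
    using irr_G irr_Hp irr_Hm \<gamma>
    unfolding irreducible_product_def range pow product[of 1, OF order_refl, symmetric]
    unfolding G_def Hp_def Hm_def T_def mult.assoc by blast
qed

end
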